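(* For $s, t \ge 3$, given any $(3,s+1;m)$-graph $G$ which has two nonadjacent vertices with at most $c_G$ common neighbors, and any $(3,t+1;n)$-graph $H$ which has two nonadjacent vertices with at most $c_H$ common neighbors, one can construct from $G$ and $H$ a $(3,s+t-1;\,m+n-c_G-c_H-4)$-graph $F$.
   Context: All graphs are simple and undirected. A $(3,k;n)$-graph is a triangle-free graph on $n$ vertices whose complement contains no $K_k$, i.e. a triangle-free graph on $n$ vertices with no independent set of $k$ vertices. Here $s,t,m,n,c_G,c_H$ denote integers. *)

theory Defs
  imports "Graph_Theory.Pair_Digraph"
begin

text \<open>
  Finite simple undirected graphs are the locale predicate \<^const>\<open>pair_graph\<close>: a finite
  vertex set with a symmetric, irreflexive set of arcs on it, so that an edge
  between u and v appears as the two arcs (u, v) and (v, u).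
\<close>

definition common_neighbors :: "'a pair_pre_digraph \<Rightarrow> 'a \<Rightarrow> 'a \<Rightarrow> 'a set" where
  "common_neighbors G u v = {w \<in> pverts G. (u, w) \<in> parcs G \<and> (v, w) \<in> parcs G}"

definition triangle_free :: "'a pair_pre_digraph \<Rightarrow> bool" where
  "triangle_free G \<longleftrightarrow>
     \<not> (\<exists>x y z. (x, y) \<in> parcs G \<and> (y, z) \<in> parcs G \<and> (x, z) \<in> parcs G)"

definition independent_set :: "'a pair_pre_digraph \<Rightarrow> 'a set \<Rightarrow> bool" where
  "independent_set G S \<longleftrightarrow> S \<subseteq> pverts G \<and> (\<forall>x\<in>S. \<forall>y\<in>S. (x, y) \<notin> parcs G)"

text \<open>
  \<open>ramsey3_graph k n G\<close> says that G is a (3, k; n)-graph. A clique on k vertices in the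
  complement of G is the same thing as an independent set of k vertices of G.
\<close>

definition ramsey3_graph :: "nat \<Rightarrow> nat \<Rightarrow> 'a pair_pre_digraph \<Rightarrow> bool" where
  "ramsey3_graph k n G \<longleftrightarrow>
     pair_graph G \<and> card (pverts G) = n \<and> triangle_free G \<and>
     \<not> (\<exists>S. independent_set G S \<and> card S = k)"

text \<open>The two vertices are distinct: a vertex does not count as nonadjacent to itself.\<close>

definition has_nonadjacent_pair_with_common_at_most :: "'a pair_pre_digraph \<Rightarrow> nat \<Rightarrow> bool" where
  "has_nonadjacent_pair_with_common_at_most G c \<longleftrightarrow>
     (\<exists>u\<in>pverts G. \<exists>v\<in>pverts G.
        u \<noteq> v \<and> (u, v) \<notin> parcs G \<and> card (common_neighbors G u v) \<le> c)"

end

theory Submission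
  imports Defs
begin

text \<open>
  Delete from G the nonadjacent vertices u, v and their common neighbours, delete likewise x, y
  and their common neighbours from H, and then join N(u) completely to N(x) and N(v) completely
  to N(y). Neighbourhoods are independent, and after the deletion N(u), N(v) are disjoint, as
  are N(x), N(y), so no triangle appears. An independent set of the new graph misses N(u) or N(x),
  and misses N(v) or N(y). Each missed neighbourhood allows its centre to be added to the part of
  the set in G or in H, so the two parts together have at most s + t - 2 vertices.
\<close>

section \<open>Simple graphs and their independent sets\<close>

lemma pair_graph_iff:
  "pair_graph G \<longleftrightarrow> finite (pverts G) \<and> parcs G \<subseteq> pverts G \<times> pverts G \<and> sym (parcs G) \<and> irrefl (parcs G)"
  (is "_ \<longleftrightarrow> ?R")
proof
  assume "pair_graph G"
  then interpret pair_graph G .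
  have "parcs G \<subseteq> pverts G \<times> pverts G"
    by (intro subsetI) (simp add: mem_Times_iff arc_fst_in_verts arc_snd_in_verts)
  moreover have "sym (parcs G)"
    using pair_sym_arcs by (simp add: symmetric_def)
  moreover have "irrefl (parcs G)"
    unfolding irrefl_def using pair_no_loops by force
  ultimately show ?R
    using pair_finite_verts by blast
next
  assume R: ?R
  then have "finite (parcs G)"
    by (meson finite_SigmaI finite_subset)
  with R show "pair_graph G"
    by unfold_locales (auto simp: symmetric_def irrefl_def)
qed

lemma pair_graph_sym: "pair_graph G \<Longrightarrow> (a, b) \<in> parcs G \<longleftrightarrow> (b, a) \<in> parcs G"
  by (meson pair_graph_iff symD)

lemma pair_graph_no_loop: "pair_graph G \<Longrightarrow> (a, a) \<notin> parcs G"
  by (auto simp: pair_graph_iff irrefl_def)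

lemma independent_set_mono:
  "independent_set G S \<Longrightarrow> T \<subseteq> S \<Longrightarrow> independent_set G T"
  by (auto simp: independent_set_def)

lemma independent_set_insert:
  assumes "pair_graph G" "independent_set G S" "u \<in> pverts G" "\<And>a. a \<in> S \<Longrightarrow> (u, a) \<notin> parcs G"
  shows "independent_set G (insert u S)"
  using assms(2-4) pair_graph_no_loop[OF assms(1)] pair_graph_sym[OF assms(1), of _ u]
  unfolding independent_set_def by blast

text \<open>The definition excludes only independent sets of exactly \<open>Suc k\<close> vertices;
  a larger one would contain such a set, since subsets of independent sets are independent.\<close>

lemma ramsey3_graph_card_independent_le:
  assumes "ramsey3_graph (Suc k) n G" "independent_set G S"
  shows "card S \<le> k"
proof (rule ccontr)
  assume "\<not> card S \<le> k"
  then obtain T where "T \<subseteq> S" "card T = Suc k"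
    by (meson not_less_eq_eq obtain_subset_with_card_n)
  with assms show False
    by (auto simp: ramsey3_graph_def dest: independent_set_mono)
qed

lemma ramsey3_graph_finite: "ramsey3_graph k n G \<Longrightarrow> finite (pverts G)"
  by (simp add: ramsey3_graph_def pair_graph_iff)

section \<open>Deleting two vertices and their common neighbours\<close>

definition private_verts :: "'a pair_pre_digraph \<Rightarrow> 'a \<Rightarrow> 'a \<Rightarrow> 'a set" where
  "private_verts G u v = pverts G - {u, v} - common_neighbors G u v"

text \<open>A lower bound is enough: the final vertex set is cut out of the remaining vertices with
  the exact size wanted.\<close>

lemma card_private_verts_ge:
  assumes "finite (pverts G)"
  shows "card (pverts G) - 2 - card (common_neighbors G u v) \<le> card (private_verts G u v)"
proof -
  have "card {u, v} \<le> 2"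
    by (simp add: card_insert_if)
  moreover have "card (pverts G) - card {u, v} \<le> card (pverts G - {u, v})"
    by (rule diff_card_le_card_Diff) simp
  moreover have "finite (common_neighbors G u v)"
    using assms by (simp add: common_neighbors_def)
  then have "card (pverts G - {u, v}) - card (common_neighbors G u v) \<le> card (private_verts G u v)"
    unfolding private_verts_def by (rule diff_card_le_card_Diff)
  ultimately show ?thesis
    by linarith
qed

text \<open>\<open>S\<close> contains neither \<open>u\<close> nor \<open>v\<close>, so each centre
  whose neighbourhood \<open>S\<close> misses can be added and raises the size by exactly one.
  Adding both keeps independence because \<open>u\<close> and \<open>v\<close> are
  nonadjacent.\<close>

lemma ramsey3_graph_card_independent_private:
  assumes G: "ramsey3_graph (Suc k) n G"
    and uv: "u \<in> pverts G" "v \<in> pverts G" "u \<noteq> v" "(u, v) \<notin> parcs G"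
    and S: "independent_set G S" "S \<subseteq> private_verts G u v"
  shows "card S \<le> k"
    and "\<forall>a\<in>S. (u, a) \<notin> parcs G \<Longrightarrow> card S + 1 \<le> k"
    and "\<forall>a\<in>S. (v, a) \<notin> parcs G \<Longrightarrow> card S + 1 \<le> k"
    and "\<forall>a\<in>S. (u, a) \<notin> parcs G \<and> (v, a) \<notin> parcs G \<Longrightarrow> card S + 2 \<le> k"
proof -
  have pg: "pair_graph G"
    using G by (simp add: ramsey3_graph_def)
  have fin: "finite S"
    using S(1) ramsey3_graph_finite[OF G] by (auto simp: independent_set_def intro: finite_subset)
  have notin: "u \<notin> S" "v \<notin> S"
    using S(2) by (auto simp: private_verts_def)
  note bound = ramsey3_graph_card_independent_le[OF G]
  note ins = independent_set_insert[OF pg]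
  show "card S \<le> k"
    by (rule bound[OF S(1)])
  show "card S + 1 \<le> k" if "\<forall>a\<in>S. (u, a) \<notin> parcs G"
    using bound[OF ins[OF S(1) uv(1)]] that fin notin by simp
  show "card S + 1 \<le> k" if "\<forall>a\<in>S. (v, a) \<notin> parcs G"
    using bound[OF ins[OF S(1) uv(2)]] that fin notin by simp
  show "card S + 2 \<le> k" if "\<forall>a\<in>S. (u, a) \<notin> parcs G \<and> (v, a) \<notin> parcs G"
  proof -
    have "independent_set G (insert v S)"
      using ins[OF S(1) uv(2)] that by blast
    then have "independent_set G (insert u (insert v S))"
      using ins[OF _ uv(1)] that uv(4) by blast
    from bound[OF this] show ?thesis
      using fin notin uv(3) by simp
  qed
qed

section \<open>The glued graph and its triangles\<close>

fun glued_adj ::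
  "'a pair_pre_digraph \<Rightarrow> 'b pair_pre_digraph \<Rightarrow> 'a \<Rightarrow> 'a \<Rightarrow> 'b \<Rightarrow> 'b \<Rightarrow> 'a + 'b \<Rightarrow> 'a + 'b \<Rightarrow> bool" where
  "glued_adj G H u v x y (Inl a) (Inl a') \<longleftrightarrow> (a, a') \<in> parcs G"
| "glued_adj G H u v x y (Inr b) (Inr b') \<longleftrightarrow> (b, b') \<in> parcs H"
| "glued_adj G H u v x y (Inl a) (Inr b) \<longleftrightarrow>
     (u, a) \<in> parcs G \<and> (x, b) \<in> parcs H \<or> (v, a) \<in> parcs G \<and> (y, b) \<in> parcs H"
| "glued_adj G H u v x y (Inr b) (Inl a) \<longleftrightarrow>
     (u, a) \<in> parcs G \<and> (x, b) \<in> parcs H \<or> (v, a) \<in> parcs G \<and> (y, b) \<in> parcs H"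

text \<open>The vertex set \<open>W\<close> is a parameter so that the order can be adjusted. In
  use, \<open>W\<close> contains none of the four centres; they only serve to name the
  neighbourhoods being joined.\<close>

definition glued_graph ::
  "'a pair_pre_digraph \<Rightarrow> 'b pair_pre_digraph \<Rightarrow> 'a \<Rightarrow> 'a \<Rightarrow> 'b \<Rightarrow> 'b \<Rightarrow> ('a + 'b) set
    \<Rightarrow> ('a + 'b) pair_pre_digraph" where
  "glued_graph G H u v x y W =
     \<lparr>pverts = W, parcs = {(p, q). p \<in> W \<and> q \<in> W \<and> glued_adj G H u v x y p q}\<rparr>"

lemma pair_graph_glued_graph:
  assumes "pair_graph G" "pair_graph H" "finite W"
  shows "pair_graph (glued_graph G H u v x y W)"
proof -
  have sym: "glued_adj G H u v x y p q \<Longrightarrow> glued_adj G H u v x y q p" for p q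
    by (cases p; cases q) (simp_all add: pair_graph_sym[OF assms(1)] pair_graph_sym[OF assms(2)])
  have "\<not> glued_adj G H u v x y p p" for p
    using assms by (cases p) (auto dest: pair_graph_no_loop)
  with sym show ?thesis
    unfolding pair_graph_iff glued_graph_def using assms(3) by (auto simp: sym_def irrefl_def)
qed

text \<open>A triangle not inside one part has two adjacent vertices in one part and its third
  vertex in the other. That third vertex lies in only one of the two joined neighbourhoods of its
  part, so the adjacent two share a centre as neighbour and form a triangle with it in
  \<open>G\<close> or \<open>H\<close>.\<close>

lemma triangle_free_glued_graph:
  assumes "pair_graph G" "triangle_free G" "pair_graph H" "triangle_free H"
    and W: "W \<subseteq> private_verts G u v <+> private_verts H x y"
  shows "triangle_free (glued_graph G H u v x y W)"
proof -
  \<comment> \<open>This is where the deletion of common neighbours matters.\<close>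
  have disjG: "\<not> ((u, a) \<in> parcs G \<and> (v, a) \<in> parcs G)" if "Inl a \<in> W" for a
    using W that by (auto simp: private_verts_def common_neighbors_def)
  have disjH: "\<not> ((x, b) \<in> parcs H \<and> (y, b) \<in> parcs H)" if "Inr b \<in> W" for b
    using W that by (auto simp: private_verts_def common_neighbors_def)
  have triG: "\<not> ((w, a) \<in> parcs G \<and> (w, a') \<in> parcs G \<and> (a, a') \<in> parcs G)" for w a a'
    using assms(2) unfolding triangle_free_def by blast
  have triH: "\<not> ((w, b) \<in> parcs H \<and> (w, b') \<in> parcs H \<and> (b, b') \<in> parcs H)" for w b b'
    using assms(4) unfolding triangle_free_def by blast
  have GGH: "\<not> (glued_adj G H u v x y (Inl a) (Inr b) \<and> glued_adj G H u v x y (Inl a') (Inr b)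
      \<and> (a, a') \<in> parcs G)" if "Inr b \<in> W" for a a' b
    unfolding glued_adj.simps using disjH[OF that] triG[of u a a'] triG[of v a a'] by blast
  have GHH: "\<not> (glued_adj G H u v x y (Inl a) (Inr b) \<and> glued_adj G H u v x y (Inl a) (Inr b')
      \<and> (b, b') \<in> parcs H)" if "Inl a \<in> W" for a b b'
    unfolding glued_adj.simps using disjG[OF that] triH[of x b b'] triH[of y b b'] by blast
  have flip: "glued_adj G H u v x y (Inr b) (Inl a) = glued_adj G H u v x y (Inl a) (Inr b)" for a b
    by simp
  \<comment> \<open>Cross adjacency stays folded from here on, so that \<open>GGH\<close> and
    \<open>GHH\<close> apply directly and \<open>flip\<close> can turn every cross edge to run from
    \<open>Inl\<close> to \<open>Inr\<close>.\<close>
  note glued_adj.simps(3,4) [simp del]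
  have no_triangle: "\<not> (glued_adj G H u v x y p q \<and> glued_adj G H u v x y q r \<and> glued_adj G H u v x y p r)"
    if "p \<in> W" "q \<in> W" "r \<in> W" for p q r
  proof (cases p; cases q; cases r)
    fix a a' a'' assume "p = Inl a" "q = Inl a'" "r = Inl a''"
    then show ?thesis using triG[of a a' a''] by auto
  next
    fix a a' b assume "p = Inl a" "q = Inl a'" "r = Inr b"
    then show ?thesis using GGH[of b a a'] that by auto
  next
    fix a b a' assume "p = Inl a" "q = Inr b" "r = Inl a'"
    then show ?thesis using GGH[of b a a'] that by (auto simp: flip)
  next
    fix a b b' assume "p = Inl a" "q = Inr b" "r = Inr b'"
    then show ?thesis using GHH[of a b b'] that by auto
  next
    fix b a a' assume "p = Inr b" "q = Inl a" "r = Inl a'"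
    then show ?thesis using GGH[of b a a'] that by (auto simp: flip)
  next
    fix b a b' assume "p = Inr b" "q = Inl a" "r = Inr b'"
    then show ?thesis using GHH[of a b b'] that by (auto simp: flip)
  next
    fix b b' a assume "p = Inr b" "q = Inr b'" "r = Inl a"
    then show ?thesis using GHH[of a b b'] that by (auto simp: flip)
  next
    fix b b' b'' assume "p = Inr b" "q = Inr b'" "r = Inr b''"
    then show ?thesis using triH[of b b' b''] by auto
  qed
  show ?thesis
    unfolding triangle_free_def
  proof clarify
    fix p q r
    assume "(p, q) \<in> parcs (glued_graph G H u v x y W)" "(q, r) \<in> parcs (glued_graph G H u v x y W)"
      "(p, r) \<in> parcs (glued_graph G H u v x y W)"
    then show False
      using no_triangle[of p q r] by (simp add: glued_graph_def)
  qed
qed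

section \<open>Independent sets of the glued graph\<close>

lemma independent_glued_graph_parts:
  assumes "independent_set (glued_graph G H u v x y W) S"
    and "W \<subseteq> private_verts G u v <+> private_verts H x y"
  shows "independent_set G (Inl -` S)" "Inl -` S \<subseteq> private_verts G u v"
    and "independent_set H (Inr -` S)" "Inr -` S \<subseteq> private_verts H x y"
    and "(\<forall>a\<in>Inl -` S. (u, a) \<notin> parcs G) \<or> (\<forall>b\<in>Inr -` S. (x, b) \<notin> parcs H)"
    and "(\<forall>a\<in>Inl -` S. (v, a) \<notin> parcs G) \<or> (\<forall>b\<in>Inr -` S. (y, b) \<notin> parcs H)"
proof -
  have SW: "S \<subseteq> W"
    using assms(1) by (auto simp: independent_set_def glued_graph_def)
  then have nonadj: "\<not> glued_adj G H u v x y p q" if "p \<in> S" "q \<in> S" for p q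
    using assms(1) that by (auto simp: independent_set_def glued_graph_def)
  show subG: "Inl -` S \<subseteq> private_verts G u v" and subH: "Inr -` S \<subseteq> private_verts H x y"
    using SW assms(2) by auto
  have "private_verts G u v \<subseteq> pverts G" "private_verts H x y \<subseteq> pverts H"
    by (auto simp: private_verts_def)
  with subG subH show "independent_set G (Inl -` S)" "independent_set H (Inr -` S)"
    using nonadj[of "Inl _" "Inl _"] nonadj[of "Inr _" "Inr _"]
    unfolding independent_set_def by auto
  \<comment> \<open>The joins are complete: a vertex of \<open>S\<close> in N(u) and one in N(x)
    would be adjacent, and likewise for N(v) and N(y).\<close>
  show "(\<forall>a\<in>Inl -` S. (u, a) \<notin> parcs G) \<or> (\<forall>b\<in>Inr -` S. (x, b) \<notin> parcs H)"
    and "(\<forall>a\<in>Inl -` S. (v, a) \<notin> parcs G) \<or> (\<forall>b\<in>Inr -` S. (y, b) \<notin> parcs H)"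
    using nonadj[of "Inl _" "Inr _"] by auto
qed

text \<open>The parts alone would allow s + t independent vertices. Each of the two joins lowers
  this by one, to s + t - 2, which the condition on \<open>k\<close> places below
  \<open>k\<close>.\<close>

lemma ramsey3_graph_glued_graph:
  assumes G: "ramsey3_graph (Suc s) m G" and H: "ramsey3_graph (Suc t) n H"
    and uv: "u \<in> pverts G" "v \<in> pverts G" "u \<noteq> v" "(u, v) \<notin> parcs G"
    and xy: "x \<in> pverts H" "y \<in> pverts H" "x \<noteq> y" "(x, y) \<notin> parcs H"
    and W: "W \<subseteq> private_verts G u v <+> private_verts H x y"
    and k: "s + t < k + 2"
  shows "ramsey3_graph k (card W) (glued_graph G H u v x y W)"
proof -
  let ?F = "glued_graph G H u v x y W"
  have "finite (private_verts G u v <+> private_verts H x y)"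
    using ramsey3_graph_finite[OF G] ramsey3_graph_finite[OF H] by (simp add: private_verts_def)
  then have fin: "finite W"
    using W by (rule rev_finite_subset)
  have "card S \<noteq> k" if S: "independent_set ?F S" for S
  proof -
    note parts = independent_glued_graph_parts[OF S W]
    note boundG = ramsey3_graph_card_independent_private[OF G uv parts(1,2)]
    note boundH = ramsey3_graph_card_independent_private[OF H xy parts(3,4)]
    have "finite S"
      using S fin by (auto simp: independent_set_def glued_graph_def intro: finite_subset)
    then have finS: "finite (Inl -` S)" "finite (Inr -` S)"
      by (simp_all add: finite_vimageI)
    have "S = (Inl -` S) <+> (Inr -` S)"
    proof (rule set_eqI)
      show "p \<in> S \<longleftrightarrow> p \<in> (Inl -` S) <+> (Inr -` S)" for p
        by (cases p) auto
    qed
    then have "card S = card (Inl -` S) + card (Inr -` S)"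
      using card_Plus[OF finS] by simp
    \<comment> \<open>For each join, one of the two parts misses its neighbourhood. Both savings
      fall on the same part (first and last case) or one falls on each part.\<close>
    moreover have "card (Inl -` S) + card (Inr -` S) + 2 \<le> s + t"
      using parts(5,6)
    proof (elim disjE)
      assume "\<forall>a\<in>Inl -` S. (u, a) \<notin> parcs G" "\<forall>a\<in>Inl -` S. (v, a) \<notin> parcs G"
      then show ?thesis using boundG(4) boundH(1) by fastforce
    next
      assume "\<forall>a\<in>Inl -` S. (u, a) \<notin> parcs G" "\<forall>b\<in>Inr -` S. (y, b) \<notin> parcs H"
      then show ?thesis using boundG(2) boundH(3) by linarith
    next
      assume "\<forall>b\<in>Inr -` S. (x, b) \<notin> parcs H" "\<forall>a\<in>Inl -` S. (v, a) \<notin> parcs G"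
      then show ?thesis using boundG(3) boundH(2) by linarith
    next
      assume "\<forall>b\<in>Inr -` S. (x, b) \<notin> parcs H" "\<forall>b\<in>Inr -` S. (y, b) \<notin> parcs H"
      then show ?thesis using boundG(1) boundH(4) by fastforce
    qed
    ultimately show ?thesis using k by linarith
  qed
  moreover have "pair_graph ?F" "triangle_free ?F"
    using G H W fin by (simp_all add: ramsey3_graph_def pair_graph_glued_graph triangle_free_glued_graph)
  ultimately show ?thesis
    unfolding ramsey3_graph_def by (auto simp: glued_graph_def)
qed

theorem mainTheorem4:
  fixes s t m n c\<^sub>G c\<^sub>H :: nat
    and G :: "'a pair_pre_digraph"
    and H :: "'b pair_pre_digraph"
  assumes "s \<ge> 3" and "t \<ge> 3"
    and "ramsey3_graph (s + 1) m G"
    and "has_nonadjacent_pair_with_common_at_most G c\<^sub>G"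
    and "ramsey3_graph (t + 1) n H"
    and "has_nonadjacent_pair_with_common_at_most H c\<^sub>H"
    and "c\<^sub>G + c\<^sub>H + 4 \<le> m + n"
  shows "\<exists>F :: ('a + 'b) pair_pre_digraph.
           ramsey3_graph (s + t - 1) (m + n - c\<^sub>G - c\<^sub>H - 4) F"
proof -
  have G: "ramsey3_graph (Suc s) m G" and H: "ramsey3_graph (Suc t) n H"
    using assms by simp_all
  obtain u v where uv: "u \<in> pverts G" "v \<in> pverts G" "u \<noteq> v" "(u, v) \<notin> parcs G"
    and cG: "card (common_neighbors G u v) \<le> c\<^sub>G"
    using assms(4) by (auto simp: has_nonadjacent_pair_with_common_at_most_def)
  obtain x y where xy: "x \<in> pverts H" "y \<in> pverts H" "x \<noteq> y" "(x, y) \<notin> parcs H"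
    and cH: "card (common_neighbors H x y) \<le> c\<^sub>H"
    using assms(6) by (auto simp: has_nonadjacent_pair_with_common_at_most_def)
  let ?V = "private_verts G u v <+> private_verts H x y"
  have finG: "finite (pverts G)" and finH: "finite (pverts H)"
    using G H by (simp_all add: ramsey3_graph_finite)
  have "m - 2 - card (common_neighbors G u v) \<le> card (private_verts G u v)"
    "n - 2 - card (common_neighbors H x y) \<le> card (private_verts H x y)"
    using card_private_verts_ge[OF finG] card_private_verts_ge[OF finH] G H
    by (auto simp: ramsey3_graph_def)
  moreover have "card ?V = card (private_verts G u v) + card (private_verts H x y)"
    using finG finH by (simp add: card_Plus private_verts_def)
  \<comment> \<open>Truncated subtraction in the two lower bounds can only raise their sum, so the
    estimate survives.\<close>
  ultimately have "m + n - c\<^sub>G - c\<^sub>H - 4 \<le> card ?V"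
    using cG cH by linarith
  \<comment> \<open>More vertices than required may remain, because \<open>c\<^sub>G\<close> and
    \<open>c\<^sub>H\<close> are only upper bounds; the surplus is discarded.\<close>
  then obtain W where "W \<subseteq> ?V" "card W = m + n - c\<^sub>G - c\<^sub>H - 4"
    by (meson obtain_subset_with_card_n)
  moreover have "s + t < s + t - 1 + 2"
    by linarith
  ultimately show ?thesis
    using ramsey3_graph_glued_graph[OF G H uv xy, of W "s + t - 1"] by auto
qed

end
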